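(* Let $q$ be a prime power, let $k,m$ be positive integers and let $i$ be an integer with $2\le i<m$. Let $U$ be an $\mathbb{F}_q$-subspace of $\mathbb{F}_{q^m}^k$ of dimension $n$ such that $L_U$ is an $i$-club in $\mathrm{PG}(k-1,q^m)$. Then \[ n\le \begin{cases} \frac{mk}{2} & \text{if } i\le m/2,\\[2pt] \frac{m(k-1)}{2}+i & \text{if } i\ge m/2.\end{cases}\]
   Context: $\mathbb{F}_{q^m}^k$ is regarded both as a $k$-dimensional $\mathbb{F}_{q^m}$-space and as an $mk$-dimensional $\mathbb{F}_q$-space, and $\mathrm{PG}(k-1,q^m)$ is its projective space. For an $\mathbb{F}_q$-subspace $U$, the $\mathbb{F}_q$-linear set $L_U=\{\langle u\rangle_{\mathbb{F}_{q^m}} : u\in U\setminus\{0\}\}$ has rank $\dim_{\mathbb{F}_q}U$. The weight of a projective subspace $\mathrm{PG}(W,\mathbb{F}_{q^m})$ ($W$ an $\mathbb{F}_{q^m}$-subspace) is $w_{L_U}(\mathrm{PG}(W,\mathbb{F}_{q^m}))=\dim_{\mathbb{F}_q}(U\cap W)$. $L_U$ is an $i$-club if exactly one point of $L_U$ has weight $i$ and all other points of $L_U$ have weight $1$. *)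

theory Defs
  imports "HOL-Analysis.Analysis" "HOL-Number_Theory.Prime_Powers"
begin

text \<open>
  The extension of finite fields is given by two field types, \<open>'f\<close> for the small field and
  \<open>'e\<close> for the large one, together with a unital ring homomorphism \<open>\<iota>\<close> (automatically
  injective).
\<close>

definition field_embedding :: "('f::field \<Rightarrow> 'e::field) \<Rightarrow> bool" where
  "field_embedding \<iota> \<longleftrightarrow>
     \<iota> 1 = 1 \<and> (\<forall>x y. \<iota> (x + y) = \<iota> x + \<iota> y) \<and> (\<forall>x y. \<iota> (x * y) = \<iota> x * \<iota> y)"

definition scale_along :: "('f::field \<Rightarrow> 'e::field) \<Rightarrow> 'f \<Rightarrow> 'e ^ 'k \<Rightarrow> 'e ^ 'k" where
  "scale_along \<iota> c v = \<iota> c *s v"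

lemma vector_space_scale_along:
  assumes "field_embedding \<iota>"
  shows "vector_space (scale_along \<iota> :: 'f::field \<Rightarrow> 'e::field ^ 'k \<Rightarrow> 'e ^ 'k)"
  using assms
  by unfold_locales
    (simp_all add: field_embedding_def scale_along_def vec_eq_iff algebra_simps)

abbreviation small_subspace :: "('f::field \<Rightarrow> 'e::field) \<Rightarrow> ('e ^ 'k) set \<Rightarrow> bool" where
  "small_subspace \<iota> \<equiv> module.subspace (scale_along \<iota>)"

abbreviation small_dim :: "('f::field \<Rightarrow> 'e::field) \<Rightarrow> ('e ^ 'k) set \<Rightarrow> nat" where
  "small_dim \<iota> \<equiv> vector_space.dim (scale_along \<iota>)"

text \<open>Projective subspaces, in particular points, are represented by the underlying
  \<open>'e\<close>-subspaces of \<open>'e ^ 'k\<close>.\<close>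

definition linear_set :: "('e::field ^ 'k) set \<Rightarrow> ('e ^ 'k) set set" where
  "linear_set U = {vec.span {u} | u. u \<in> U - {0}}"

definition weight :: "('f::field \<Rightarrow> 'e::field) \<Rightarrow> ('e ^ 'k) set \<Rightarrow> ('e ^ 'k) set \<Rightarrow> nat" where
  "weight \<iota> U W = small_dim \<iota> (U \<inter> W)"

definition is_club :: "('f::field \<Rightarrow> 'e::field) \<Rightarrow> nat \<Rightarrow> ('e ^ 'k) set \<Rightarrow> bool" where
  "is_club \<iota> i U \<longleftrightarrow>
     (\<exists>!P. P \<in> linear_set U \<and> weight \<iota> U P = i) \<and>
     (\<forall>P\<in>linear_set U. weight \<iota> U P \<noteq> i \<longrightarrow> weight \<iota> U P = 1)"

end

theory Submission
  imports Defs
begin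

text \<open>
  Write \<open>Q = q ^ m\<close>, \<open>N = q ^ n\<close>, \<open>I = q ^ i\<close>, and let \<open>x\<^sub>l\<close> be the number of vectors of \<open>U\<close> killed by
  the linear functional \<open>l\<close>. As \<open>x\<^sub>l\<close> is a power of \<open>q\<close>, no such number lies strictly between
  \<open>N / Q\<close> and \<open>q N / Q\<close>, so \<open>(Q x\<^sub>l - N) (Q x\<^sub>l - q N)\<close> is nonnegative for every \<open>l\<close>. Hence its sum over
  all \<open>l\<close> is at least its value at \<open>l = 0\<close>. The first two moments of \<open>x\<^sub>l\<close> are found by
  counting functionals that kill one or two vectors of \<open>U\<close>, and the second moment only involves
  the weights of the points. For an \<open>i\<close>-club the result is
  \<open>N\<^sup>2 (Q - q) \<le> Q ^ k (Q - q + (I - 1) (I - q))\<close>, which implies both bounds because it places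
  \<open>N\<^sup>2\<close> strictly below twice the desired power of \<open>q\<close>.
\<close>

section \<open>Cardinalities of kernels and subspaces over finite fields\<close>

text \<open>Every fibre is a translate of the kernel. This serves to count the functionals killing
  one or two given vectors.\<close>

lemma card_eq_card_kernel_times_card:
  fixes f :: "'a::{ab_group_add,finite} \<Rightarrow> 'b::{ab_group_add,finite}"
  assumes add: "\<And>x y. f (x + y) = f x + f y" and "surj f"
  shows "CARD('a) = CARD('b) * card {x. f x = 0}"
proof -
  have fibre: "card {x. f x = y} = card {x. f x = 0}" for y
  proof -
    obtain z where z: "f z = y" using \<open>surj f\<close> by (metis surjD)
    have "{x. f x = y} = (\<lambda>x. z + x) ` {x. f x = 0}"
    proof (intro set_eqI iffI)
      fix x assume "x \<in> {x. f x = y}"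
      then have "f (x - z) = 0" using add[of z "x - z"] z by simp
      then show "x \<in> (\<lambda>x. z + x) ` {x. f x = 0}" by (intro image_eqI[of _ _ "x - z"]) auto
    qed (auto simp: add z)
    then show ?thesis by (simp add: card_image)
  qed
  have "CARD('a) = card (\<Union>y. {x. f x = y})" by (simp add: UNION_eq)
  also have "\<dots> = (\<Sum>y\<in>UNIV. card {x. f x = y})" by (rule card_UN_disjoint) auto
  also have "\<dots> = (\<Sum>y\<in>(UNIV :: 'b set). card {x. f x = 0})" by (intro sum.cong refl fibre)
  finally show ?thesis by simp
qed

text \<open>Each new basis vector \<open>b\<close> multiplies the size by \<open>CARD('a)\<close>,
  since independence makes \<open>(c, x) \<mapsto> scale c b + x\<close> injective.\<close>

lemma (in vector_space) card_span_independent: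
  assumes "finite (UNIV :: 'a set)" "finite B" "independent B"
  shows "finite (span B) \<and> card (span B) = CARD('a) ^ card B"
  using assms(2,3)
proof (induction B rule: finite_induct)
  case (insert b B)
  have ind: "independent B" and b: "b \<notin> span B"
    using insert by (auto simp: independent_insert)
  have eq: "span (insert b B) = (\<lambda>(c, x). scale c b + x) ` (UNIV \<times> span B)"
    unfolding span_insert
  proof (intro set_eqI iffI)
    fix x assume "x \<in> {x. \<exists>k. x - scale k b \<in> span B}"
    then obtain k where "x - scale k b \<in> span B" by blast
    then show "x \<in> (\<lambda>(c, x). scale c b + x) ` (UNIV \<times> span B)"
      by (intro image_eqI[of _ _ "(k, x - scale k b)"]) auto
  next
    fix x assume "x \<in> (\<lambda>(c, x). scale c b + x) ` (UNIV \<times> span B)"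
    then obtain c y where "x = scale c b + y" "y \<in> span B" by auto
    then have "x - scale c b \<in> span B" by simp
    then show "x \<in> {x. \<exists>k. x - scale k b \<in> span B}" by blast
  qed
  have "inj_on (\<lambda>(c, x). scale c b + x) (UNIV \<times> span B)"
  proof (rule inj_onI, clarify)
    fix c x d y
    assume xy: "x \<in> span B" "y \<in> span B" and e: "scale c b + x = scale d b + y"
    have diff: "scale (c - d) b = y - x"
      using e by (simp add: scale_left_diff_distrib algebra_simps)
    then have "scale (c - d) b \<in> span B" using xy by (simp add: span_diff)
    then have "c = d"
      using b span_scale[of "scale (c - d) b" B "inverse (c - d)"] by (cases "c = d") auto
    then show "c = d \<and> x = y" using e by simp
  qed
  then show ?case
    using insert.IH[OF ind] insert.hyps assms(1) unfolding eq
    by (simp add: card_image card_cartesian_product)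
qed simp

lemma (in vector_space) card_subspace:
  assumes "finite (UNIV :: 'a set)" "subspace S" "finite S"
  shows "card S = CARD('a) ^ dim S"
proof -
  obtain B where B: "B \<subseteq> S" "independent B" "S \<subseteq> span B" "card B = dim S"
    using basis_exists by blast
  then have "span B = S" using assms span_minimal by blast
  then show ?thesis
    using card_span_independent[of B] assms B finite_subset by metis
qed

section \<open>Linear functionals and the vectors they kill\<close>

text \<open>A functional is encoded by its coefficient vector \<open>l\<close>, so that sums over
  all functionals range over the finite type \<open>'e ^ 'k\<close>.\<close>

definition functional :: "'e::comm_ring_1 ^ 'k \<Rightarrow> 'e ^ 'k \<Rightarrow> 'e" where
  "functional l u = (\<Sum>j\<in>UNIV. l $ j * u $ j)"

lemma functional_add_left: "functional (l + l') u = functional l u + functional l' u"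
  by (simp add: functional_def distrib_right sum.distrib)

lemma functional_add_right: "functional l (u + v) = functional l u + functional l v"
  by (simp add: functional_def distrib_left sum.distrib)

lemma functional_scale_right: "functional l (c *s u) = c * functional l u"
  by (simp add: functional_def sum_distrib_left mult.left_commute)

lemma functional_0_left [simp]: "functional 0 u = 0"
  and functional_0_right [simp]: "functional l 0 = 0"
  by (simp_all add: functional_def)

lemma functional_axis: "functional (axis a c) u = c * u $ a"
  by (simp add: functional_def axis_def if_distrib[of "\<lambda>x. x * _"] cong: if_cong)

lemma card_annihilator_one:
  fixes u :: "'e::{field,finite} ^ 'k"
  assumes "u \<noteq> 0"
  shows "CARD('e) * card {l. functional l u = 0} = CARD('e) ^ CARD('k)"
proof -
  obtain a where a: "u $ a \<noteq> 0" using assms by (auto simp: vec_eq_iff)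
  have "surj (\<lambda>l. functional l u)"
    by (rule surjI[of _ "\<lambda>s. axis a (s / u $ a)"]) (simp add: functional_axis a)
  from card_eq_card_kernel_times_card[OF _ this] show ?thesis
    by (simp add: functional_add_left CARD_vec)
qed

text \<open>If all 2 by 2 minors vanished, \<open>v\<close> would be a multiple of \<open>u\<close>,
  with the ratio read off at a coordinate where \<open>u\<close> is nonzero.\<close>

lemma exists_nonzero_minor:
  fixes u v :: "'e::field ^ 'k"
  assumes "u \<noteq> 0" "v \<notin> vec.span {u}"
  shows "\<exists>a b. u $ a * v $ b - u $ b * v $ a \<noteq> 0"
proof (rule ccontr)
  assume *: "\<not> ?thesis"
  obtain a where a: "u $ a \<noteq> 0" using assms by (auto simp: vec_eq_iff)
  have "v = (v $ a / u $ a) *s u"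
    unfolding vec_eq_iff
  proof
    fix b
    from * have "u $ a * v $ b - u $ b * v $ a = 0" by blast
    then show "v $ b = ((v $ a / u $ a) *s u) $ b" using a by (simp add: field_simps)
  qed
  then show False using assms(2) by (metis vec.span_base vec.span_scale singletonI)
qed

lemma card_annihilator_two:
  fixes u v :: "'e::{field,finite} ^ 'k"
  assumes "u \<noteq> 0" "v \<notin> vec.span {u}"
  shows "CARD('e) ^ 2 * card {l. functional l u = 0 \<and> functional l v = 0} = CARD('e) ^ CARD('k)"
proof -
  obtain a b where D: "u $ a * v $ b - u $ b * v $ a \<noteq> 0"
    using exists_nonzero_minor[OF assms] by blast
  define D where "D = u $ a * v $ b - u $ b * v $ a"
  \<comment> \<open>Cramer's rule: \<open>?l (s, t)\<close> is supported on the coordinates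
    \<open>a\<close> and \<open>b\<close> and takes the values \<open>s\<close> at \<open>u\<close>
    and \<open>t\<close> at \<open>v\<close>. Hence joint evaluation is onto and its kernel has
    index \<open>CARD('e) ^ 2\<close>.\<close>
  let ?l = "\<lambda>(s, t). axis a ((s * v $ b - t * u $ b) / D) + axis b ((t * u $ a - s * v $ a) / D)"
  have "surj (\<lambda>l. (functional l u, functional l v))"
  proof (rule surjI[of _ ?l])
    fix p :: "'e \<times> 'e"
    obtain s t where p: "p = (s, t)" by (cases p)
    have "(s * v $ b - t * u $ b) * u $ a + (t * u $ a - s * v $ a) * u $ b = s * D"
      "(s * v $ b - t * u $ b) * v $ a + (t * u $ a - s * v $ a) * v $ b = t * D"
      by (simp_all add: D_def algebra_simps)
    moreover have "D \<noteq> 0" using D by (simp add: D_def)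
    ultimately show "(functional (?l p) u, functional (?l p) v) = p"
      by (simp add: p functional_add_left functional_axis flip: add_divide_distrib)
  qed
  from card_eq_card_kernel_times_card[OF _ this] show ?thesis
    by (simp add: functional_add_left CARD_vec zero_prod_def power2_eq_square card_cartesian_product
        flip: UNIV_Times_UNIV)
qed

text \<open>For \<open>v\<close> in the span of \<open>u\<close> the second condition follows from
  the first, which saves one factor \<open>CARD('e)\<close>. This factor is how the weights of
  points enter the second moment.\<close>

lemma card_annihilator_pair:
  fixes u v :: "'e::{field,finite} ^ 'k"
  assumes "u \<noteq> 0"
  shows "CARD('e) ^ 2 * card {l. functional l u = 0 \<and> functional l v = 0} =
    CARD('e) ^ CARD('k) * (if v \<in> vec.span {u} then CARD('e) else 1)"
proof (cases "v \<in> vec.span {u}")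
  case True
  then obtain c where "v = c *s u" by (auto simp: vec.span_singleton)
  then have "{l. functional l u = 0 \<and> functional l v = 0} = {l. functional l u = 0}"
    by (auto simp: functional_scale_right)
  then show ?thesis
    using card_annihilator_one[OF assms] True by (simp add: power2_eq_square)
qed (simp add: card_annihilator_two[OF assms])

section \<open>First and second moments of the number of killed vectors\<close>

lemma real_card_Diff_singleton:
  assumes "finite A" "x \<in> A"
  shows "real (card (A - {x})) = real (card A) - 1"
  using card_Suc_Diff1[OF assms] by linarith

lemma card_filter_sum:
  assumes "finite A"
  shows "real (card {x \<in> A. P x}) = (\<Sum>x\<in>A. of_bool (P x))"
  using assms by (simp add: Int_def)

lemma sum_card_annihilated_swap:
  fixes U :: "('e::{field,finite} ^ 'k) set"
  shows "(\<Sum>l\<in>UNIV. real (card {u \<in> U. functional l u = 0})) =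
    (\<Sum>u\<in>U. real (card {l. functional l u = 0}))"
proof -
  have "(\<Sum>l\<in>UNIV. real (card {u \<in> U. functional l u = 0})) =
      (\<Sum>l\<in>UNIV. \<Sum>u\<in>U. of_bool (functional l u = 0))"
    by (simp only: card_filter_sum finite)
  also have "\<dots> = (\<Sum>u\<in>U. \<Sum>l\<in>UNIV. of_bool (functional l u = 0))"
    by (rule sum.swap)
  finally show ?thesis
    using card_filter_sum[of "UNIV :: ('e ^ 'k) set"] by simp
qed

text \<open>Double counting of pairs \<open>(l, u)\<close>: the zero vector is killed by every
  functional, any other vector by one in \<open>CARD('e)\<close> of them. The factor in front avoids
  the exponent \<open>CARD('k) - 1\<close>.\<close>

lemma sum_card_annihilated:
  fixes U :: "('e::{field,finite} ^ 'k) set"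
  assumes "0 \<in> U"
  shows "real CARD('e) * (\<Sum>l\<in>UNIV. real (card {u \<in> U. functional l u = 0})) =
    real CARD('e) ^ CARD('k) * (real CARD('e) + real (card U) - 1)"
proof -
  let ?Q = "real CARD('e)"
  have "?Q * (\<Sum>l\<in>UNIV. real (card {u \<in> U. functional l u = 0})) =
      (\<Sum>u\<in>U. ?Q * real (card {l. functional l u = 0}))"
    by (simp add: sum_card_annihilated_swap sum_distrib_left)
  also have "\<dots> = (\<Sum>u\<in>U. ?Q ^ CARD('k) * (if u = 0 then ?Q else 1))"
  proof (rule sum.cong)
    fix u :: "'e ^ 'k"
    show "?Q * real (card {l. functional l u = 0}) = ?Q ^ CARD('k) * (if u = 0 then ?Q else 1)"
      using arg_cong[OF card_annihilator_one[of u], of real] by (simp add: CARD_vec)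
  qed simp
  also have "\<dots> = ?Q ^ CARD('k) * (?Q + real (card (U - {0})))"
    using assms by (simp add: sum.remove[of U 0] distrib_left)
  finally show ?thesis using assms by (simp add: real_card_Diff_singleton del: card_Diff_insert)
qed

text \<open>The square counts pairs \<open>(u, v)\<close> killed by \<open>l\<close>, so after
  exchanging sums it remains to count the common annihilators of each pair.\<close>

lemma sum_card_annihilated_squared:
  fixes U :: "('e::{field,finite} ^ 'k) set"
  assumes "0 \<in> U"
  shows "real CARD('e) ^ 2 * (\<Sum>l\<in>UNIV. (real (card {u \<in> U. functional l u = 0})) ^ 2) =
    real CARD('e) ^ CARD('k) * (real CARD('e) * (real CARD('e) + real (card U) - 1)
      + (real (card U) - 1) * real (card U)
      + (real CARD('e) - 1) * (\<Sum>u\<in>U - {0}. real (card (U \<inter> vec.span {u}))))"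
proof -
  let ?Q = "real CARD('e)"
  let ?T = "\<lambda>u v. ?Q ^ 2 * real (card {l. functional l u = 0 \<and> functional l v = 0})"
  have "?Q ^ 2 * (\<Sum>l\<in>UNIV. (real (card {u \<in> U. functional l u = 0})) ^ 2) =
     ?Q ^ 2 * (\<Sum>l\<in>UNIV. \<Sum>u\<in>U. \<Sum>v\<in>U. of_bool (functional l u = 0 \<and> functional l v = 0))"
    by (simp only: card_filter_sum finite power2_eq_square sum_product of_bool_conj)
  also have "\<dots> = ?Q ^ 2 * (\<Sum>u\<in>U. \<Sum>v\<in>U. \<Sum>l\<in>UNIV. of_bool (functional l u = 0 \<and> functional l v = 0))"
    by (subst sum.swap, subst sum.swap[of _ UNIV U]) (rule refl)
  also have "\<dots> = (\<Sum>u\<in>U. \<Sum>v\<in>U. ?T u v)"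
    using card_filter_sum[of "UNIV :: ('e ^ 'k) set"] by (simp add: sum_distrib_left)
  also have "\<dots> = (\<Sum>v\<in>U. ?T 0 v) + (\<Sum>u\<in>U - {0}. \<Sum>v\<in>U. ?T u v)"
    by (rule sum.remove) (use assms in auto)
  \<comment> \<open>For \<open>u = 0\<close> only the condition on \<open>v\<close> is left, so this
    part is the first moment again.\<close>
  also have "(\<Sum>v\<in>U. ?T 0 v) =
      ?Q * (?Q * (\<Sum>l\<in>UNIV. real (card {u \<in> U. functional l u = 0})))"
    by (simp add: sum_card_annihilated_swap sum_distrib_left power2_eq_square mult.assoc)
  also have "\<dots> = ?Q ^ CARD('k) * (?Q * (?Q + real (card U) - 1))"
    by (simp add: sum_card_annihilated[OF assms])
  also have "(\<Sum>u\<in>U - {0}. \<Sum>v\<in>U. ?T u v) =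
     (\<Sum>u\<in>U - {0}. ?Q ^ CARD('k) * (real (card U) + (?Q - 1) * real (card (U \<inter> vec.span {u}))))"
  proof (rule sum.cong)
    fix u assume u: "u \<in> U - {0}"
    \<comment> \<open>The case distinction on \<open>v\<close> becomes an indicator with coefficient
      \<open>?Q - 1\<close>, whose sum counts \<open>U \<inter> vec.span {u}\<close>.\<close>
    have "(\<Sum>v\<in>U. ?T u v) = (\<Sum>v\<in>U. ?Q ^ CARD('k) * (1 + (?Q - 1) * of_bool (v \<in> vec.span {u})))"
    proof (rule sum.cong)
      fix v
      show "?T u v = ?Q ^ CARD('k) * (1 + (?Q - 1) * of_bool (v \<in> vec.span {u}))"
        using u arg_cong[OF card_annihilator_pair[of u v], of real] by simp
    qed simp
    also have "\<dots> = ?Q ^ CARD('k) * (real (card U) + (?Q - 1) * (\<Sum>v\<in>U. of_bool (v \<in> vec.span {u})))"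
      by (simp add: sum.distrib flip: sum_distrib_left)
    also have "(\<Sum>v\<in>U. of_bool (v \<in> vec.span {u})) = real (card (U \<inter> vec.span {u}))"
      by (simp add: Int_def flip: card_filter_sum)
    finally show "(\<Sum>v\<in>U. ?T u v) =
        ?Q ^ CARD('k) * (real (card U) + (?Q - 1) * real (card (U \<inter> vec.span {u})))" .
  qed simp
  also have "\<dots> = ?Q ^ CARD('k) * (real (card (U - {0})) * real (card U)
      + (?Q - 1) * (\<Sum>u\<in>U - {0}. real (card (U \<inter> vec.span {u}))))"
    by (simp add: sum.distrib flip: sum_distrib_left)
  also have "real (card (U - {0})) = real (card U) - 1"
    using assms by (simp add: real_card_Diff_singleton del: card_Diff_insert)
  finally show ?thesis by (simp add: distrib_left add.assoc)
qed

section \<open>The inequality from the gap between consecutive powers\<close>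

text \<open>The roots \<open>q ^ b\<close> and \<open>q ^ Suc b\<close> are consecutive powers, so
  \<open>q ^ a\<close> is at most the smaller or at least the larger one.\<close>

lemma power_gap_nonneg:
  fixes q :: real
  assumes "q \<ge> 1"
  shows "(q ^ a - q ^ b) * (q ^ a - q * q ^ b) \<ge> 0"
proof (cases "a \<le> b")
  case True
  then have "q ^ a \<le> q ^ b" using assms by (rule power_increasing)
  moreover have "q ^ b \<le> q * q ^ b" using assms by simp
  ultimately show ?thesis by (intro mult_nonpos_nonpos) auto
next
  case False
  then have "q ^ Suc b \<le> q ^ a" using assms by (intro power_increasing) auto
  moreover have "q ^ b \<le> q * q ^ b" using assms by simp
  ultimately show ?thesis by (intro mult_nonneg_nonneg) auto
qed

lemma sum_power_gap_le:
  fixes U :: "('e::{field,finite} ^ 'k) set" and q :: real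
  assumes "0 \<in> U" "q \<ge> 1" "real CARD('e) = q ^ m" "real (card U) = q ^ n"
    and pow: "\<And>l. \<exists>d. real (card {u \<in> U. functional l u = 0}) = q ^ d"
  shows "(q ^ n) ^ 2 * (q ^ m - 1) * (q ^ m - q) \<le>
    (q ^ m) ^ CARD('k) * (q ^ m * (q ^ m + q ^ n - 1) + (q ^ n - 1) * q ^ n
      + (q ^ m - 1) * (\<Sum>u\<in>U - {0}. real (card (U \<inter> vec.span {u})))
      - (q + 1) * q ^ n * (q ^ m + q ^ n - 1) + q * (q ^ n) ^ 2)"
proof -
  define x where "x l = real (card {u \<in> U. functional l u = 0})" for l :: "'e ^ 'k"
  define g where "g l = (q ^ m * x l - q ^ n) * (q ^ m * x l - q * q ^ n)" for l
  have "g l \<ge> 0" for l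
  proof -
    obtain d where "x l = q ^ d" using pow unfolding x_def by blast
    then show ?thesis
      \<comment> \<open>Multiplied by \<open>q ^ m\<close>, the count \<open>x l\<close> is still a
        power of \<open>q\<close>, now comparable with \<open>q ^ n\<close> without
        division.\<close>
      using power_gap_nonneg[OF \<open>q \<ge> 1\<close>, of "m + d" n] by (simp add: g_def power_add)
  qed
  then have "g 0 \<le> sum g UNIV" by (intro member_le_sum) auto
  moreover have "g 0 = (q ^ n) ^ 2 * (q ^ m - 1) * (q ^ m - q)"
    using assms(4) by (simp add: g_def x_def algebra_simps power2_eq_square)
  moreover have "sum g UNIV = (q ^ m) ^ 2 * (\<Sum>l\<in>UNIV. x l ^ 2)
      - (q + 1) * q ^ n * (q ^ m * (\<Sum>l\<in>UNIV. x l)) + q * (q ^ n) ^ 2 * (q ^ m) ^ CARD('k)"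
  proof -
    have "g l = (q ^ m) ^ 2 * x l ^ 2 - (q + 1) * q ^ n * (q ^ m * x l) + q * (q ^ n) ^ 2" for l
      by (simp add: g_def algebra_simps power2_eq_square)
    then show ?thesis
      by (simp add: sum.distrib sum_subtractf sum_distrib_left CARD_vec assms(3))
  qed
  \<comment> \<open>Pulls out the factor \<open>(q ^ m) ^ CARD('k)\<close> shared by both moments
    and the constant term.\<close>
  moreover have "P * A - c * (P * B) + d * P = P * (A - c * B + d)" for P A B c d :: real
    by (simp add: algebra_simps)
  ultimately show ?thesis
    using sum_card_annihilated[OF assms(1)] sum_card_annihilated_squared[OF assms(1)]
    unfolding assms(3,4) x_def by (simp only:)
qed

section \<open>Subspaces over the small field and the weights of a club\<close>

lemma vec_span_singleton_eq:
  fixes u w :: "'e::field ^ 'k"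
  assumes "u \<in> vec.span {w}" "u \<noteq> 0"
  shows "vec.span {u} = vec.span {w}"
proof -
  obtain c where c: "u = c *s w" using assms by (auto simp: vec.span_singleton)
  with assms have "c \<noteq> 0" by auto
  then have "w = inverse c *s u" by (simp add: c vector_smult_assoc)
  then have "w \<in> vec.span {u}" by (metis vec.span_base vec.span_scale singletonI)
  with assms show ?thesis by (simp add: vec.span_minimal subset_antisym)
qed

lemma small_subspace_0:
  fixes U :: "('e::field ^ 'k) set"
  assumes "field_embedding \<iota>" "small_subspace \<iota> U"
  shows "0 \<in> U"
proof -
  interpret S: vector_space "scale_along \<iota> :: _ \<Rightarrow> 'e ^ 'k \<Rightarrow> _"
    by (rule vector_space_scale_along) fact
  show ?thesis using assms(2) by (rule S.subspace_0)
qed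

lemma small_subspace_Int_span:
  fixes U :: "('e::field ^ 'k) set"
  assumes "field_embedding \<iota>" "small_subspace \<iota> U"
  shows "small_subspace \<iota> (U \<inter> vec.span W)"
proof -
  interpret S: vector_space "scale_along \<iota> :: _ \<Rightarrow> 'e ^ 'k \<Rightarrow> _"
    by (rule vector_space_scale_along) fact
  show ?thesis
    using assms(2) unfolding S.subspace_def
    by (auto simp: vec.span_zero vec.span_add vec.span_scale scale_along_def)
qed

text \<open>Functionals are linear over the large field, hence over the small one. This is why the
  number of killed vectors is a power of \<open>CARD('f)\<close>.\<close>

lemma small_subspace_kernel:
  fixes U :: "('e::field ^ 'k) set"
  assumes "field_embedding \<iota>" "small_subspace \<iota> U"
  shows "small_subspace \<iota> {u \<in> U. functional l u = 0}"
proof -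
  interpret S: vector_space "scale_along \<iota> :: _ \<Rightarrow> 'e ^ 'k \<Rightarrow> _"
    by (rule vector_space_scale_along) fact
  show ?thesis
    using assms(2) unfolding S.subspace_def
    by (auto simp: functional_add_right functional_scale_right scale_along_def)
qed

lemma card_small_subspace:
  fixes \<iota> :: "'f::{field,finite} \<Rightarrow> 'e::{field,finite}" and S :: "('e ^ 'k) set"
  assumes "field_embedding \<iota>" "small_subspace \<iota> S"
  shows "card S = CARD('f) ^ small_dim \<iota> S"
  by (rule vector_space.card_subspace[OF vector_space_scale_along]) (use assms in auto)

text \<open>With \<open>P\<close> the point of weight \<open>i\<close>, each nonzero vector of
  \<open>U\<close> on \<open>P\<close> contributes \<open>?q ^ i\<close>, and each vector of
  \<open>U\<close> off \<open>P\<close> spans a point of weight 1 and contributes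
  \<open>?q\<close>.\<close>

lemma club_sum_card_points:
  fixes \<iota> :: "'f::{field,finite} \<Rightarrow> 'e::{field,finite}" and U :: "('e ^ 'k) set"
  assumes "field_embedding \<iota>" "small_subspace \<iota> U" "is_club \<iota> i U"
  shows "(\<Sum>u\<in>U - {0}. real (card (U \<inter> vec.span {u}))) =
    (real CARD('f) ^ i - 1) * real CARD('f) ^ i + (real (card U) - real CARD('f) ^ i) * real CARD('f)"
proof -
  let ?q = "real CARD('f)"
  obtain P where P: "P \<in> linear_set U" "weight \<iota> U P = i"
    and uniq: "\<And>P'. P' \<in> linear_set U \<Longrightarrow> weight \<iota> U P' = i \<Longrightarrow> P' = P"
    and one: "\<And>P'. P' \<in> linear_set U \<Longrightarrow> weight \<iota> U P' \<noteq> i \<Longrightarrow> weight \<iota> U P' = 1"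
    using assms(3) unfolding is_club_def by metis
  obtain w where w: "P = vec.span {w}" "w \<in> U" using P by (auto simp: linear_set_def)
  have card: "real (card (U \<inter> vec.span W)) = ?q ^ weight \<iota> U (vec.span W)" for W
    using card_small_subspace[OF assms(1) small_subspace_Int_span[OF assms(1,2)]]
    by (simp add: weight_def)
  have 0: "0 \<in> U \<inter> P"
    using small_subspace_0[OF assms(1,2)] w by (simp add: vec.span_zero)
  have cardP: "real (card (U \<inter> P)) = ?q ^ i" using card[of "{w}"] P w by simp
  have "(\<Sum>u\<in>U - {0}. real (card (U \<inter> vec.span {u}))) =
     (\<Sum>u\<in>U - {0}. if u \<in> P then ?q ^ i else ?q)"
  proof (rule sum.cong)
    fix u assume u: "u \<in> U - {0}"
    then have mem: "vec.span {u} \<in> linear_set U" by (auto simp: linear_set_def)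
    show "real (card (U \<inter> vec.span {u})) = (if u \<in> P then ?q ^ i else ?q)"
    proof (cases "u \<in> P")
      case True
      then show ?thesis using vec_span_singleton_eq[of u w] u w cardP by simp
    next
      case False
      then have "vec.span {u} \<noteq> P" using vec.span_base[of u "{u}"] by auto
      then show ?thesis using False one[OF mem] uniq[OF mem] card[of "{u}"] by fastforce
    qed
  qed simp
  \<comment> \<open>Zero lies in \<open>P\<close>, so it has to be removed from the first index set
    only.\<close>
  also have "\<dots> = (\<Sum>u\<in>U \<inter> P - {0}. ?q ^ i) + (\<Sum>u\<in>U - U \<inter> P. ?q)"
  proof -
    have "(U - {0}) \<inter> {u. u \<in> P} = U \<inter> P - {0}" "(U - {0}) \<inter> - {u. u \<in> P} = U - U \<inter> P"
      using 0 by auto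
    then show ?thesis by (simp add: sum.If_cases)
  qed
  also have "\<dots> = real (card (U \<inter> P - {0})) * ?q ^ i + real (card (U - U \<inter> P)) * ?q"
    by simp
  also have "real (card (U \<inter> P - {0})) = ?q ^ i - 1"
    using real_card_Diff_singleton[OF _ 0] cardP by simp
  also have "real (card (U - U \<inter> P)) = real (card U) - ?q ^ i"
    using cardP card_mono[of U "U \<inter> P"]
    by (simp add: card_Diff_subset of_nat_diff del: of_nat_power flip: of_nat_power)
  finally show ?thesis .
qed

lemma club_card_inequality:
  fixes \<iota> :: "'f::{field,finite} \<Rightarrow> 'e::{field,finite}" and U :: "('e ^ 'k) set"
  assumes emb: "field_embedding \<iota>" and U: "small_subspace \<iota> U" and "is_club \<iota> i U"
    and "CARD('e) = CARD('f) ^ m" "m > 0"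
  defines "q \<equiv> real CARD('f)" and "n \<equiv> small_dim \<iota> U"
  shows "(q ^ n) ^ 2 * (q ^ m - q) \<le> (q ^ m) ^ CARD('k) * (q ^ m - q + (q ^ i - 1) * (q ^ i - q))"
proof -
  have q: "q > 1"
    using card_mono[of UNIV "{0 :: 'f, 1}"] by (simp add: q_def)
  have zero: "0 \<in> U"
    by (rule small_subspace_0[OF emb U])
  have cardU: "real (card U) = q ^ n"
    using card_small_subspace[OF emb U] by (simp add: q_def n_def)
  have cardE: "real CARD('e) = q ^ m" using assms by simp
  have pow: "\<exists>d. real (card {u \<in> U. functional l u = 0}) = q ^ d" for l
    using card_small_subspace[OF emb small_subspace_kernel[OF emb U]] by (auto simp: q_def)
  have "(q ^ n) ^ 2 * (q ^ m - 1) * (q ^ m - q) \<le>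
    (q ^ m) ^ CARD('k) * (q ^ m * (q ^ m + q ^ n - 1) + (q ^ n - 1) * q ^ n
      + (q ^ m - 1) * ((q ^ i - 1) * q ^ i + (q ^ n - q ^ i) * q)
      - (q + 1) * q ^ n * (q ^ m + q ^ n - 1) + q * (q ^ n) ^ 2)"
    using sum_power_gap_le[OF zero _ cardE cardU pow] q
      club_sum_card_points[OF assms(1-3), folded q_def] by (simp add: cardU)
  \<comment> \<open>On the right all terms containing \<open>q ^ n\<close> cancel, and what remains
    is divisible by \<open>q ^ m - 1\<close>, a factor of the left side too.\<close>
  also have "\<dots> = (q ^ m) ^ CARD('k) * (q ^ m - q + (q ^ i - 1) * (q ^ i - q)) * (q ^ m - 1)"
    by (simp add: algebra_simps power2_eq_square)
  finally have "((q ^ n) ^ 2 * (q ^ m - q)) * (q ^ m - 1) \<le>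
      ((q ^ m) ^ CARD('k) * (q ^ m - q + (q ^ i - 1) * (q ^ i - q))) * (q ^ m - 1)"
    by (simp add: mult_ac)
  moreover have "q ^ m - 1 > 0" using q \<open>m > 0\<close> by (simp add: one_less_power)
  ultimately show ?thesis by (rule mult_right_le_imp_le)
qed

section \<open>From the cardinality inequality to the bounds on the rank\<close>

text \<open>Exceeding \<open>b\<close> by one already multiplies the power by
  \<open>q \<ge> 2\<close>, so a strict loss below the factor 2 costs nothing in the
  exponent.\<close>

lemma exponent_le_of_power_less_double:
  fixes q :: real
  assumes "q \<ge> 2" "q ^ a < 2 * q ^ b"
  shows "a \<le> b"
proof (rule ccontr)
  assume "\<not> a \<le> b"
  then have "q ^ Suc b \<le> q ^ a" using assms by (intro power_increasing) auto
  moreover have "2 * q ^ b \<le> q * q ^ b" using assms by simp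
  ultimately show False using assms(2) by simp
qed

theorem theorem4p8:
  fixes \<iota> :: "'f::{field,finite} \<Rightarrow> 'e::{field,finite}"
    and U :: "('e ^ 'k) set"
    and q k m i n :: nat
  assumes "primepow q" and "k > 0" and "m > 0"
    and "CARD('f) = q" and "CARD('e) = q ^ m" and "CARD('k) = k"
    and "field_embedding \<iota>"
    and "2 \<le> i" and "i < m"
    and "small_subspace \<iota> U" and "small_dim \<iota> U = n"
    and "is_club \<iota> i U"
  shows "(real i \<le> real m / 2 \<longrightarrow> real n \<le> real m * real k / 2) \<and>
         (real i \<ge> real m / 2 \<longrightarrow> real n \<le> real m * (real k - 1) / 2 + real i)"
proof -
  define r where "r = real q"
  define Q I where "Q = r ^ m" and "I = r ^ i"
  have r: "r \<ge> 2" using primepow_gt_Suc_0[OF assms(1)] by (simp add: r_def)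
  have "r ^ 1 < Q" unfolding Q_def using r assms(8,9) by (intro power_strict_increasing) auto
  then have Qr: "r < Q" by simp
  have I: "r \<le> I" unfolding I_def using r assms(8) power_increasing[of 1 i r] by simp
  have rI: "r * I \<le> Q"
    unfolding Q_def I_def using r assms(9) power_increasing[of "Suc i" m r] by simp
  have main: "(r ^ n) ^ 2 * (Q - r) \<le> Q ^ k * (Q - r + (I - 1) * (I - r))"
    using club_card_inequality[OF assms(7,10,12), of m] assms(3-6,11)
    by (simp add: r_def Q_def I_def)
  have first: "2 * n \<le> m * k" if "2 * i \<le> m"
  proof -
    have "I ^ 2 \<le> Q"
      unfolding I_def Q_def power_even_eq[symmetric] using r that by (intro power_increasing) auto
    \<comment> \<open>In the expansion of \<open>(I - 1) * (I - r)\<close> below,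
      \<open>r * I\<close> outweighs \<open>2 * r\<close>, and \<open>- I\<close> makes the
      comparison with \<open>Q - r\<close> strict.\<close>
    moreover have "r * 2 \<le> r * I" using r I by (intro mult_left_mono) auto
    moreover have "(I - 1) * (I - r) = I ^ 2 - r * I - I + r"
      by (simp add: algebra_simps power2_eq_square)
    ultimately have "(I - 1) * (I - r) < Q - r" using I r by linarith
    then have "Q ^ k * (Q - r + (I - 1) * (I - r)) < Q ^ k * (2 * (Q - r))"
      using Qr r by (intro mult_strict_left_mono) auto
    also have "\<dots> = (2 * Q ^ k) * (Q - r)" by simp
    finally have "(r ^ n) ^ 2 * (Q - r) < (2 * Q ^ k) * (Q - r)" using main by linarith
    then have "(r ^ n) ^ 2 < 2 * Q ^ k" using Qr by simp
    then have "r ^ (2 * n) < 2 * r ^ (m * k)"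
      unfolding power_even_eq by (simp only: Q_def power_mult)
    then show ?thesis using exponent_le_of_power_less_double r by blast
  qed
  have second: "2 * n \<le> m * (k - 1) + 2 * i" if "m \<le> 2 * i"
  proof -
    have "Q \<le> I ^ 2"
      unfolding I_def Q_def power_even_eq[symmetric] using r that by (intro power_increasing) auto
    then have "Q * Q \<le> I ^ 2 * Q" using Qr r by (intro mult_right_mono) auto
    \<comment> \<open>The inequality aimed at has right side minus left side equal to
      \<open>(I ^ 2 * Q - Q * Q) + I * ((r + 1) * Q - 2 * (r * I))\<close>. The first summand is
      nonnegative as \<open>Q \<le> I ^ 2\<close>; the second is positive by this bound, which rests
      on \<open>i < m\<close> through \<open>rI\<close>.\<close>
    moreover have "2 * (r * I) < (r + 1) * Q"
    proof -
      have "2 * (r * I) \<le> 2 * Q" using rI by simp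
      also have "\<dots> < (r + 1) * Q" using r Qr by (intro mult_strict_right_mono) auto
      finally show ?thesis .
    qed
    then have "I * (2 * (r * I)) < I * ((r + 1) * Q)"
      using I r by (intro mult_strict_left_mono) auto
    ultimately have "Q * (Q - r + (I - 1) * (I - r)) < 2 * I ^ 2 * (Q - r)"
      by (simp add: algebra_simps power2_eq_square)
    then have "Q ^ (k - 1) * (Q * (Q - r + (I - 1) * (I - r))) < Q ^ (k - 1) * (2 * I ^ 2 * (Q - r))"
      using Qr r by (intro mult_strict_left_mono) auto
    also have "\<dots> = (2 * (Q ^ (k - 1) * I ^ 2)) * (Q - r)" by simp
    \<comment> \<open>One factor \<open>Q\<close> was split off \<open>Q ^ k\<close>, which is
      possible as \<open>k > 0\<close>; trading it for \<open>I ^ 2\<close> yields the exponent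
      \<open>m * (k - 1) + 2 * i\<close>.\<close>
    also have "Q ^ (k - 1) * (Q * (Q - r + (I - 1) * (I - r))) = Q ^ k * (Q - r + (I - 1) * (I - r))"
      using assms(2) by (simp add: power_eq_if)
    finally have "(r ^ n) ^ 2 * (Q - r) < (2 * (Q ^ (k - 1) * I ^ 2)) * (Q - r)"
      using main by linarith
    then have "(r ^ n) ^ 2 < 2 * (Q ^ (k - 1) * I ^ 2)" using Qr by simp
    then have "r ^ (2 * n) < 2 * r ^ (m * (k - 1) + 2 * i)"
      unfolding power_add power_even_eq by (simp only: Q_def I_def power_mult)
    then show ?thesis using exponent_le_of_power_less_double r by blast
  qed
  show ?thesis
  proof (intro conjI impI)
    assume "real i \<le> real m / 2"
    then have "real (2 * n) \<le> real (m * k)" using first by (intro of_nat_mono) linarith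
    then show "real n \<le> real m * real k / 2" by simp
  next
    assume "real i \<ge> real m / 2"
    then have "real (2 * n) \<le> real (m * (k - 1) + 2 * i)" using second by (intro of_nat_mono) linarith
    then show "real n \<le> real m * (real k - 1) / 2 + real i"
      using assms(2) by (simp add: of_nat_diff Suc_leI)
  qed
qed

end
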